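(* Let $n\geq 2$ be an integer, let $\mathcal{C}$ be a uniformly random integrated coloring of the cycle $C_n$, and let $k$ be an integer with $\lceil n/4\rceil\leq k\leq\lfloor n/2\rfloor$. Then \[\Pr[\mathrm{mix}(\mathcal{C})=2k]=\frac{2\binom{2k-1}{n-2k}+4\binom{2k-1}{n-2k-1}}{\mathrm{ic}(C_n)}.\]
   Context: Let $G=(V,E)$ be a finite labeled graph (or multigraph). A coloring of $G$ is an arbitrary map $\mathcal{C}: V \to \{\text{black},\text{white}\}$. An edge is balanced if its endpoints have different colors. The mixing number $\mathrm{mix}(\mathcal{C})$ is the number of balanced edges of $G$. For a vertex $v$, $\mathrm{mix}(v)$ is the number of balanced edges incident to $v$. A vertex $v$ is integrated if $\mathrm{mix}(v)\geq \frac12\deg(v)$, and $\mathcal{C}$ is integrated if every vertex is integrated. $\mathrm{ic}(G)$ is the number of integrated colorings of $G$. The cycle $C_n$ has labeled vertices $1,\dots,n$ with $i$ joined to $i+1$ modulo $n$; $C_2$ is the multigraph of two vertices joined by two parallel edges. Binomial convention: $\binom{a}{b}=0$ if $b<0$ or $b>a$ (for $a\ge 0$). *)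

theory Defs
  imports "HOL-Probability.Probability_Mass_Function"
begin

text \<open>
  Undirected multigraphs with named edges: parallel edges are distinct elements of \<open>edges\<close>
  with the same set of endpoints, and an edge whose set of endpoints is a singleton is a loop.
\<close>

record ('v, 'e) multigraph =
  verts :: "'v set"
  edges :: "'e set"
  ends :: "'e \<Rightarrow> 'v set"

definition finite_multigraph :: "('v, 'e) multigraph \<Rightarrow> bool" where
  "finite_multigraph G \<longleftrightarrow> finite (verts G) \<and> finite (edges G) \<and>
     (\<forall>e\<in>edges G. ends G e \<subseteq> verts G \<and> card (ends G e) \<in> {1, 2})"

text \<open>A loop counts twice in the degree.\<close>

definition degree :: "('v, 'e) multigraph \<Rightarrow> 'v \<Rightarrow> nat" where
  "degree G v = card {e \<in> edges G. v \<in> ends G e} + card {e \<in> edges G. ends G e = {v}}"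

datatype color = Black | White

definition colorings :: "('v, 'e) multigraph \<Rightarrow> ('v \<Rightarrow> color) set" where
  "colorings G = verts G \<rightarrow>\<^sub>E UNIV"

definition balanced :: "('v, 'e) multigraph \<Rightarrow> ('v \<Rightarrow> color) \<Rightarrow> 'e \<Rightarrow> bool" where
  "balanced G C e \<longleftrightarrow> (\<exists>u v. ends G e = {u, v} \<and> C u \<noteq> C v)"

definition mix :: "('v, 'e) multigraph \<Rightarrow> ('v \<Rightarrow> color) \<Rightarrow> nat" where
  "mix G C = card {e \<in> edges G. balanced G C e}"

definition mix_at :: "('v, 'e) multigraph \<Rightarrow> ('v \<Rightarrow> color) \<Rightarrow> 'v \<Rightarrow> nat" where
  "mix_at G C v = card {e \<in> edges G. v \<in> ends G e \<and> balanced G C e}"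

definition integrated_at :: "('v, 'e) multigraph \<Rightarrow> ('v \<Rightarrow> color) \<Rightarrow> 'v \<Rightarrow> bool" where
  "integrated_at G C v \<longleftrightarrow> real (mix_at G C v) \<ge> 1 / 2 * real (degree G v)"

definition integrated :: "('v, 'e) multigraph \<Rightarrow> ('v \<Rightarrow> color) \<Rightarrow> bool" where
  "integrated G C \<longleftrightarrow> (\<forall>v\<in>verts G. integrated_at G C v)"

definition integrated_colorings :: "('v, 'e) multigraph \<Rightarrow> ('v \<Rightarrow> color) set" where
  "integrated_colorings G = {C \<in> colorings G. integrated G C}"

definition ic :: "('v, 'e) multigraph \<Rightarrow> nat" where
  "ic G = card (integrated_colorings G)"

text \<open>
  Edge \<open>i\<close> joins \<open>i\<close> to its cyclic successor in \<open>{1..n}\<close>. For \<open>n = 2\<close> the edges \<open>1\<close> and \<open>2\<close>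
  are distinct and both have endpoints \<open>{1, 2}\<close>, so this is the double edge.
\<close>

definition cycle :: "nat \<Rightarrow> (nat, nat) multigraph" where
  "cycle n = \<lparr>verts = {1..n}, edges = {1..n}, ends = (\<lambda>i. {i, i mod n + 1})\<rparr>"

text \<open>
  The lower argument is an integer because \<open>n - 2 * k - 1\<close> can be \<open>-1\<close>, where the coefficient
  has to vanish; truncated subtraction on the naturals would give \<open>1\<close> there.
\<close>

definition binom :: "int \<Rightarrow> int \<Rightarrow> nat" where
  "binom a b = (if 0 \<le> b \<and> b \<le> a then nat a choose nat b else 0)"

lemma finite_multigraph_cycle:
  assumes "n \<ge> 2"
  shows "finite_multigraph (cycle n)"
proof -
  have "i mod n + 1 \<noteq> i \<and> i mod n + 1 \<le> n" if "1 \<le> i" "i \<le> n" for i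
    using that assms by (cases "i = n") auto
  then show ?thesis
    by (fastforce simp: finite_multigraph_def cycle_def card_insert_if)
qed

text \<open>
  The uniform distribution \<open>pmf_of_set\<close> is only meaningful on finite nonempty sets; the next two
  lemmas show that the integrated colorings of a cycle form such a set.
\<close>

lemma finite_integrated_colorings:
  assumes "finite_multigraph G"
  shows "finite (integrated_colorings G)"
proof -
  have "(UNIV :: color set) = {Black, White}"
    using color.exhaust by auto
  then have "finite (UNIV :: color set)"
    by (metis finite.emptyI finite.insertI)
  then have "finite (colorings G)"
    using assms by (auto simp: colorings_def finite_multigraph_def intro: finite_PiE)
  then show ?thesis
    by (simp add: integrated_colorings_def)
qed

lemma degree_cycle:
  assumes n: "n \<ge> 2" and v: "v \<in> {1..n}"
  shows "degree (cycle n) v = 2"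
proof -
  define p where "p = (if v = 1 then n else v - 1)"
  have incident: "v \<in> {i, i mod n + 1} \<longleftrightarrow> i = v \<or> i = p" and no_loop: "i mod n + 1 \<noteq> i"
    if "i \<in> {1..n}" for i
    using that n v by (cases "i = n"; auto simp: p_def)+
  have "v \<in> {1..n}" "p \<in> {1..n}"
    using n v by (auto simp: p_def)
  then have "{i \<in> {1..n}. v \<in> {i, i mod n + 1}} = {v, p}"
    using incident by blast
  moreover have "{i \<in> {1..n}. {i, i mod n + 1} = {v}} = {}"
    using no_loop by blast
  moreover have "p \<noteq> v"
    using n v by (auto simp: p_def)
  ultimately show ?thesis
    by (simp add: degree_def cycle_def)
qed

lemma integrated_colorings_cycle_nonempty:
  assumes n: "n \<ge> 2"
  shows "integrated_colorings (cycle n) \<noteq> {}"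
proof -
  define C where "C = restrict (\<lambda>i::nat. if even i then Black else White) {1..n}"
  have bal: "balanced (cycle n) C i" if "1 \<le> i" "i < n" for i
  proof -
    have "ends (cycle n) i = {i, Suc i}" "C i \<noteq> C (Suc i)"
      using that by (auto simp: cycle_def C_def)
    then show ?thesis
      unfolding balanced_def by blast
  qed
  have "integrated_at (cycle n) C v" if v: "v \<in> {1..n}" for v
  proof -
    define e where "e = (if v < n then v else n - 1)"
    let ?S = "{e \<in> edges (cycle n). v \<in> ends (cycle n) e \<and> balanced (cycle n) C e}"
    have "e \<in> ?S"
      using n v bal[of e] by (auto simp: e_def cycle_def)
    moreover have "finite ?S"
      by (simp add: cycle_def)
    ultimately have "mix_at (cycle n) C v \<ge> 1"
      unfolding mix_at_def by (metis One_nat_def Suc_leI card_gt_0_iff empty_iff)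
    then show ?thesis
      by (simp add: integrated_at_def degree_cycle[OF n v])
  qed
  then have "C \<in> integrated_colorings (cycle n)"
    by (auto simp: integrated_colorings_def colorings_def integrated_def cycle_def C_def)
  then show ?thesis
    by blast
qed

end

theory Submission
  imports Defs
begin

text \<open>
  A coloring of \<open>C\<^sub>n\<close> is determined by the color of vertex \<open>1\<close> together with its set of balanced
  edges, because walking along the cycle the color flips exactly at the balanced edges. Coming back to
  vertex \<open>1\<close> forces the number of flips to be even, and this is the only constraint
  (\<open>bij_betw_first_color_balanced_edges\<close>). Every vertex has degree two, so the coloring is
  integrated iff no two cyclically consecutive edges are both unbalanced
  (\<open>integrated_cycle_iff\<close>).

  Hence the number of integrated colorings with \<open>2k\<close> balanced edges is twice the number of ways to
  choose \<open>u = n - 2k\<close> pairwise non-adjacent elements (the unbalanced edges) on a cycle of length \<open>n\<close>.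
  Cutting the cycle at \<open>n\<close> reduces this count to the path, where the answer is a single binomial
  coefficient (\<open>card_sparse_subsets\<close>): the sets avoiding \<open>n\<close> contribute \<open>2k choose u\<close> and
  those containing \<open>n\<close> contribute \<open>(2k - 1) choose (u - 1)\<close>. Pascal's rule turns twice the sum of
  these into the stated numerator.
\<close>

section \<open>Sparse subsets of a path and of a cycle\<close>

definition sparse :: "nat set \<Rightarrow> bool" where
  "sparse U \<longleftrightarrow> (\<forall>i\<in>U. Suc i \<notin> U)"

definition sparse_subsets :: "nat \<Rightarrow> nat \<Rightarrow> nat \<Rightarrow> nat set set" where
  "sparse_subsets l a b = {U. U \<subseteq> {l..<l + a} \<and> card U = b \<and> sparse U}"

lemma finite_sparse_subsets: "finite (sparse_subsets l a b)"
  by (rule finite_subset[of _ "Pow {l..<l + a}"]) (auto simp: sparse_subsets_def)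

lemma sparse_subsets_0: "sparse_subsets l a 0 = {{}}"
proof -
  have "U = {}" if "U \<subseteq> {l..<l + a}" "card U = 0" for U
    using that finite_subset[OF that(1)] by simp
  then show ?thesis by (auto simp: sparse_subsets_def sparse_def)
qed

text \<open>
  A set containing the last element of the interval avoids the element before it, so removing the
  last element shortens the interval by two.
\<close>

lemma card_sparse_subsets_rec:
  "card (sparse_subsets l (Suc (Suc a)) (Suc b)) =
     card (sparse_subsets l (Suc a) (Suc b)) + card (sparse_subsets l a b)"
proof -
  let ?x = "Suc (l + a)"
  have split: "sparse_subsets l (Suc (Suc a)) (Suc b) =
      sparse_subsets l (Suc a) (Suc b) \<union> insert ?x ` sparse_subsets l a b" (is "?L = ?A \<union> ?B")
  proof (intro equalityI subsetI)
    fix U assume U: "U \<in> ?L"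
    show "U \<in> ?A \<union> ?B"
    proof (cases "?x \<in> U")
      case False
      have "U \<subseteq> {l..<l + Suc a}"
      proof
        fix y assume "y \<in> U"
        with U False have "y \<in> {l..<l + Suc (Suc a)}" "y \<noteq> ?x"
          by (auto simp: sparse_subsets_def)
        then show "y \<in> {l..<l + Suc a}" by auto
      qed
      then show ?thesis using U by (auto simp: sparse_subsets_def)
    next
      case True
      have "l + a \<notin> U" using U True by (auto simp: sparse_subsets_def sparse_def)
      have "U - {?x} \<subseteq> {l..<l + a}"
      proof
        fix y assume "y \<in> U - {?x}"
        with U \<open>l + a \<notin> U\<close> have "y \<in> {l..<l + Suc (Suc a)}" "y \<noteq> ?x" "y \<noteq> l + a"
          by (auto simp: sparse_subsets_def)
        then show "y \<in> {l..<l + a}" by auto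
      qed
      moreover have "finite U"
        using U finite_subset[of U "{l..<l + Suc (Suc a)}"] by (simp add: sparse_subsets_def)
      ultimately have "U - {?x} \<in> sparse_subsets l a b"
        using U True by (auto simp: sparse_subsets_def sparse_def)
      moreover have "U = insert ?x (U - {?x})" using True by auto
      ultimately show ?thesis by blast
    qed
  next
    fix U assume "U \<in> ?A \<union> ?B"
    then show "U \<in> ?L"
    proof
      assume "U \<in> ?A"
      moreover have "{l..<l + Suc a} \<subseteq> {l..<l + Suc (Suc a)}" by simp
      ultimately show ?thesis by (simp only: sparse_subsets_def mem_Collect_eq) blast
    next
      assume "U \<in> ?B"
      then obtain V where U: "U = insert ?x V" and V: "V \<subseteq> {l..<l + a}" "card V = b" "sparse V"
        by (auto simp: sparse_subsets_def)
      have "finite V" using V(1) by (rule finite_subset) simp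
      moreover have notin: "?x \<notin> V" "Suc ?x \<notin> V" "l + a \<notin> V" using V(1) by auto
      ultimately have "card U = Suc b" using V(2) by (simp add: U)
      moreover have "sparse U" using V(3) notin by (auto simp: U sparse_def)
      moreover have "U \<subseteq> {l..<l + Suc (Suc a)}"
      proof -
        have "{l..<l + a} \<subseteq> {l..<l + Suc (Suc a)}" "?x \<in> {l..<l + Suc (Suc a)}" by simp_all
        then show ?thesis using V(1) unfolding U by blast
      qed
      ultimately show ?thesis by (simp add: sparse_subsets_def)
    qed
  qed
  have disjoint: "?A \<inter> ?B = {}"
    by (auto simp: sparse_subsets_def)
  have "inj_on (insert ?x) (sparse_subsets l a b)"
  proof (rule inj_onI)
    fix U V assume "U \<in> sparse_subsets l a b" "V \<in> sparse_subsets l a b"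
      and eq: "insert ?x U = insert ?x V"
    then have "?x \<notin> U" "?x \<notin> V" by (auto simp: sparse_subsets_def)
    with eq show "U = V" by (simp add: insert_ident)
  qed
  then show ?thesis
    by (simp add: split card_Un_disjoint disjoint finite_sparse_subsets card_image)
qed

text \<open>
  The recursion above is Pascal's rule for the diagonal coefficients. The truncated subtraction is
  harmless: it only happens for \<open>b > a + 1\<close>, where both sides vanish.
\<close>

lemma card_sparse_subsets: "card (sparse_subsets l a b) = (a + 1 - b) choose b"
proof (induction a arbitrary: b rule: less_induct)
  case (less a)
  show ?case
  proof (cases b)
    case 0
    then show ?thesis by (simp add: sparse_subsets_0)
  next
    case b: (Suc c)
    consider "a = 0" | "a = 1" | a' where "a = Suc (Suc a')"
      by (metis One_nat_def not0_implies_Suc)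
    then show ?thesis
    proof cases
      case 1
      then have "sparse_subsets l a b = {}" by (auto simp: sparse_subsets_def b)
      then show ?thesis by (simp add: 1 b)
    next
      case 2
      show ?thesis
      proof (cases "c = 0")
        case True
        have "U \<subseteq> {l..<l + 1} \<and> card U = 1 \<and> sparse U \<longleftrightarrow> U = {l}" for U
          by (auto simp: sparse_def subset_singleton_iff)
        then have "sparse_subsets l a b = {{l}}"
          using True by (simp add: sparse_subsets_def b 2)
        then show ?thesis using True by (simp add: 2 b)
      next
        case False
        have "U \<notin> sparse_subsets l a b" for U
        proof
          assume "U \<in> sparse_subsets l a b"
          then have "U \<subseteq> {l..<l + 1}" "card U = Suc c" by (simp_all add: sparse_subsets_def 2 b)
          then show False using False card_mono[of "{l..<l + 1}" U] by simp
        qed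
        then have "sparse_subsets l a b = {}" by blast
        then show ?thesis using False by (simp add: 2 b)
      qed
    next
      case 3
      have "card (sparse_subsets l a b) = ((a' + 1 - c) choose Suc c) + ((a' + 1 - c) choose c)"
        using less[of "Suc a'"] less[of a'] by (simp add: 3 b card_sparse_subsets_rec)
      also have "\<dots> = (a + 1 - b) choose b"
        by (cases "c \<le> a' + 1") (auto simp: 3 b Suc_diff_le)
      finally show ?thesis .
    qed
  qed
qed

definition cyclic_sparse :: "nat \<Rightarrow> nat set \<Rightarrow> bool" where
  "cyclic_sparse n U \<longleftrightarrow> (\<forall>i\<in>U. i mod n + 1 \<notin> U)"

lemma cyclic_sparse_iff:
  assumes "U \<subseteq> {1..n}" "n \<ge> 1"
  shows "cyclic_sparse n U \<longleftrightarrow> sparse U \<and> \<not> (1 \<in> U \<and> n \<in> U)"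
proof -
  have succ: "i mod n + 1 = (if i = n then 1 else Suc i)" if "i \<in> U" for i
  proof (cases "i = n")
    case False
    moreover have "i \<in> {1..n}" using that assms(1) by blast
    ultimately have "i < n" by simp
    then show ?thesis by simp
  qed simp
  have "cyclic_sparse n U \<longleftrightarrow> (\<forall>i\<in>U. (if i = n then 1 else Suc i) \<notin> U)"
    unfolding cyclic_sparse_def by (rule ball_cong[OF refl]) (simp only: succ)
  also have "\<dots> \<longleftrightarrow> (\<forall>i\<in>U. i \<noteq> n \<longrightarrow> Suc i \<notin> U) \<and> \<not> (1 \<in> U \<and> n \<in> U)"
    by (metis (full_types))
  also have "\<dots> \<longleftrightarrow> sparse U \<and> \<not> (1 \<in> U \<and> n \<in> U)"
  proof -
    have "Suc n \<notin> U" using assms(1) by auto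
    then show ?thesis unfolding sparse_def by metis
  qed
  finally show ?thesis .
qed

text \<open>
  Cutting the cycle at \<open>n\<close>: a set avoiding \<open>n\<close> is a sparse subset of the path \<open>1, \<dots>, n - 1\<close>; a set
  containing \<open>n\<close> avoids both neighbors \<open>n - 1\<close> and \<open>1\<close>, and the rest of it is a sparse subset of
  \<open>2, \<dots>, n - 2\<close>.
\<close>

lemma card_cyclic_sparse_subsets:
  assumes n: "n \<ge> 2"
  shows "card {U. U \<subseteq> {1..n} \<and> card U = u \<and> cyclic_sparse n U} =
    ((n - u) choose u) + (if u = 0 then 0 else (n - u - 1) choose (u - 1))"
proof -
  let ?L = "{U. U \<subseteq> {1..n} \<and> card U = u \<and> cyclic_sparse n U}"
  let ?A = "sparse_subsets 1 (n - 1) u"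
  let ?B = "if u = 0 then {} else insert n ` sparse_subsets 2 (n - 3) (u - 1)"
  have split: "?L = ?A \<union> ?B"
  proof (intro equalityI subsetI)
    fix U assume "U \<in> ?L"
    then have U: "U \<subseteq> {1..n}" "card U = u" "sparse U" "\<not> (1 \<in> U \<and> n \<in> U)"
      using n by (auto simp: cyclic_sparse_iff)
    have fin: "finite U" using U(1) by (rule finite_subset) simp
    show "U \<in> ?A \<union> ?B"
    proof (cases "n \<in> U")
      case False
      have "U \<subseteq> {1..<1 + (n - 1)}"
      proof
        fix y assume "y \<in> U"
        with U False have "y \<in> {1..n}" "y \<noteq> n" by auto
        then show "y \<in> {1..<1 + (n - 1)}" by auto
      qed
      then show ?thesis using U by (simp add: sparse_subsets_def)
    next
      case True
      have "U - {n} \<subseteq> {2..<2 + (n - 3)}"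
      proof
        fix y assume y: "y \<in> U - {n}"
        then have "Suc y \<noteq> n" "y \<noteq> 1" "y \<in> {1..n}" "y \<noteq> n"
          using U True by (auto simp: sparse_def)
        then show "y \<in> {2..<2 + (n - 3)}" by auto
      qed
      moreover have "sparse (U - {n})" using U by (auto simp: sparse_def)
      moreover have "card (U - {n}) = u - 1" using U True fin by simp
      ultimately have "U - {n} \<in> sparse_subsets 2 (n - 3) (u - 1)"
        by (simp add: sparse_subsets_def)
      moreover have "U = insert n (U - {n})" using True by auto
      ultimately have "U \<in> insert n ` sparse_subsets 2 (n - 3) (u - 1)" by blast
      moreover have "u \<noteq> 0" using U(2) True fin by (metis card_0_eq empty_iff)
      ultimately show ?thesis by simp
    qed
  next
    fix U assume "U \<in> ?A \<union> ?B"
    then show "U \<in> ?L"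
    proof
      assume "U \<in> ?A"
      then have U: "U \<subseteq> {1..<1 + (n - 1)}" "card U = u" "sparse U"
        by (auto simp: sparse_subsets_def)
      have "1 \<le> y" "y < n" if "y \<in> U" for y
        using subsetD[OF U(1) that] by auto
      then have "n \<notin> U" "U \<subseteq> {1..n}" by fastforce+
      then show ?thesis using U n by (simp add: cyclic_sparse_iff)
    next
      assume B: "U \<in> ?B"
      have u: "u \<noteq> 0" using B by (cases "u = 0") simp_all
      with B have "U \<in> insert n ` sparse_subsets 2 (n - 3) (u - 1)" by simp
      then obtain V where U: "U = insert n V" and "V \<in> sparse_subsets 2 (n - 3) (u - 1)" by blast
      then have V: "V \<subseteq> {2..<2 + (n - 3)}" "card V = u - 1" "sparse V"
        by (simp_all add: sparse_subsets_def)
      have bound: "2 \<le> y" "Suc y < n" if "y \<in> V" for y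
        using subsetD[OF V(1) that] by auto
      have fin: "finite V" using V(1) by (rule finite_subset) simp
      have notin: "n \<notin> V" "Suc n \<notin> V" "1 \<notin> V"
        using bound(2)[of n] bound(2)[of "Suc n"] bound(1)[of 1] by auto
      have sub: "U \<subseteq> {1..n}"
      proof
        fix y assume "y \<in> U"
        then show "y \<in> {1..n}" using bound[of y] n by (auto simp: U)
      qed
      have "sparse U"
        unfolding sparse_def
      proof
        fix y assume "y \<in> U"
        then consider "y \<in> V" | "y = n" by (auto simp: U)
        then show "Suc y \<notin> U"
        proof cases
          case 1
          then show ?thesis using bound(2)[of y] V(3) by (simp add: U sparse_def)
        next
          case 2
          then show ?thesis using notin(2) by (simp add: U)
        qed
      qed
      moreover have "1 \<notin> U" using notin(3) n by (auto simp: U)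
      ultimately have "cyclic_sparse n U" using sub n by (simp add: cyclic_sparse_iff)
      moreover have "card U = u" using V(2) u fin notin(1) by (simp add: U)
      ultimately show ?thesis using sub by simp
    qed
  qed
  have "n \<notin> U" if "U \<in> ?A" for U
    using that n by (auto simp: sparse_subsets_def)
  then have disjoint: "?A \<inter> ?B = {}" by auto
  have "inj_on (insert n) (sparse_subsets 2 (n - 3) (u - 1))"
  proof (rule inj_onI)
    fix U V assume "U \<in> sparse_subsets 2 (n - 3) (u - 1)" "V \<in> sparse_subsets 2 (n - 3) (u - 1)"
      and eq: "insert n U = insert n V"
    moreover have "n \<notin> {2..<2 + (n - 3)}" by auto
    ultimately have "n \<notin> U" "n \<notin> V" unfolding sparse_subsets_def by blast+
    with eq show "U = V" by (simp add: insert_ident)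
  qed
  then have "card ?B = (if u = 0 then 0 else ((n - 3 + 1) - (u - 1)) choose (u - 1))"
    by (simp add: card_image card_sparse_subsets)
  \<comment> \<open>For \<open>n = 2\<close> the truncated \<open>n - 3\<close> makes the upper argument one too large,
      but only where both coefficients agree.\<close>
  also have "\<dots> = (if u = 0 then 0 else (n - u - 1) choose (u - 1))"
  proof (cases "n = 2")
    case True
    then show ?thesis by (cases "u \<le> 1") auto
  next
    case False
    then have "n - 3 + 1 - (u - 1) = n - u - 1" if "u \<noteq> 0" using that n by arith
    then show ?thesis by (cases "u = 0") simp_all
  qed
  finally have "card ?B = \<dots>" .
  moreover have "card ?A = (n - u) choose u"
    using n by (simp add: card_sparse_subsets)
  moreover have "finite ?B" by (simp add: finite_sparse_subsets)
  ultimately show ?thesis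
    by (simp only: split card_Un_disjoint[OF finite_sparse_subsets _ disjoint])
qed

section \<open>Colorings of a cycle and their balanced edges\<close>

definition balanced_edges :: "nat \<Rightarrow> (nat \<Rightarrow> color) \<Rightarrow> nat set" where
  "balanced_edges n C = {e \<in> {1..n}. C e \<noteq> C (e mod n + 1)}"

lemma balanced_cycle_iff: "balanced (cycle n) C e \<longleftrightarrow> C e \<noteq> C (e mod n + 1)"
  unfolding balanced_def cycle_def by (auto simp: doubleton_eq_iff)

lemma mix_cycle: "mix (cycle n) C = card (balanced_edges n C)"
  unfolding mix_def balanced_edges_def balanced_cycle_iff by (simp add: cycle_def)

text \<open>
  Vertex \<open>e mod n + 1\<close> lies exactly on the edges \<open>e\<close> and \<open>e mod n + 1\<close>, and having degree two it is
  integrated as soon as one of them is balanced.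
\<close>

lemma integrated_cycle_iff:
  assumes n: "n \<ge> 2"
  shows "integrated (cycle n) C \<longleftrightarrow> cyclic_sparse n ({1..n} - balanced_edges n C)"
proof -
  let ?s = "\<lambda>i. i mod n + 1"
  have at: "integrated_at (cycle n) C (?s e) \<longleftrightarrow> \<not> (C e = C (?s e) \<and> C (?s e) = C (?s (?s e)))"
    if e: "e \<in> {1..n}" for e
  proof -
    have s: "?s e \<in> {1..n}" using n by (simp add: Suc_leI)
    have "?s e \<in> {i, ?s i} \<longleftrightarrow> i = e \<or> i = ?s e" if "i \<in> {1..n}" for i
      using that e by (cases "i = n"; cases "e = n") auto
    then have S: "{i \<in> edges (cycle n). ?s e \<in> ends (cycle n) i \<and> balanced (cycle n) C i} =
        {i \<in> {e, ?s e}. balanced (cycle n) C i}" (is "?S = _")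
      using e s by (auto simp: cycle_def)
    have "integrated_at (cycle n) C (?s e) \<longleftrightarrow> card ?S \<ge> 1"
      unfolding integrated_at_def degree_cycle[OF n s] mix_at_def by simp
    also have "\<dots> \<longleftrightarrow> ?S \<noteq> {}"
      unfolding S by (simp add: Suc_le_eq card_gt_0_iff)
    also have "\<dots> \<longleftrightarrow> \<not> (C e = C (?s e) \<and> C (?s e) = C (?s (?s e)))"
      unfolding S by (auto simp: balanced_cycle_iff)
    finally show ?thesis .
  qed
  have verts: "{1..n} = ?s ` {1..n}"
  proof (intro equalityI subsetI)
    fix v assume v: "v \<in> {1..n}"
    have "v = ?s (if v = 1 then n else v - 1)" "(if v = 1 then n else v - 1) \<in> {1..n}"
      using v n by auto
    then show "v \<in> ?s ` {1..n}" by blast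
  qed (use n in \<open>auto simp: Suc_leI\<close>)
  have "integrated (cycle n) C \<longleftrightarrow> (\<forall>e\<in>{1..n}. integrated_at (cycle n) C (?s e))"
    unfolding integrated_def using verts by (simp add: cycle_def) (metis (no_types, lifting) image_iff)
  also have "\<dots> \<longleftrightarrow> (\<forall>e\<in>{1..n}. \<not> (C e = C (?s e) \<and> C (?s e) = C (?s (?s e))))"
    using at by blast
  also have "\<dots> \<longleftrightarrow> cyclic_sparse n ({1..n} - balanced_edges n C)"
  proof -
    have "?s e \<in> {1..n}" for e using n by (simp add: Suc_leI)
    then show ?thesis unfolding cyclic_sparse_def balanced_edges_def by blast
  qed
  finally show ?thesis .
qed

lemma card_edges_before_Suc:
  "card {e \<in> D. e < Suc v} = card {e \<in> D. e < v} + (if v \<in> D then 1 else (0::nat))"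
proof -
  have "{e \<in> D. e < Suc v} = (if v \<in> D then insert v {e \<in> D. e < v} else {e \<in> D. e < v})"
    by (auto simp: less_Suc_eq)
  then show ?thesis by simp
qed

text \<open>
  The color flips at each balanced edge passed on the way from vertex \<open>1\<close> to vertex \<open>v\<close>.
\<close>

lemma color_eq_first_iff:
  assumes "v \<in> {1..n}"
  shows "C v = C 1 \<longleftrightarrow> even (card {e \<in> balanced_edges n C. e < v})"
proof -
  have "1 \<le> v" "v \<le> n" using assms by auto
  then show ?thesis
  proof (induction v rule: dec_induct)
    case base
    have "{e \<in> balanced_edges n C. e < 1} = {}" by (auto simp: balanced_edges_def)
    then show ?case by (metis card.empty even_zero)
  next
    case (step v)
    then have "v \<in> balanced_edges n C \<longleftrightarrow> C v \<noteq> C (Suc v)"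
      by (simp add: balanced_edges_def)
    moreover have "C v = C 1 \<longleftrightarrow> even (card {e \<in> balanced_edges n C. e < v})"
      using step by simp
    \<comment> \<open>There are only two colors, so differing from the same color means being equal.\<close>
    moreover have "C (Suc v) = C 1 \<longleftrightarrow> (C v = C 1 \<longleftrightarrow> C v = C (Suc v))"
      by (cases "C v"; cases "C (Suc v)"; cases "C 1") simp_all
    ultimately show ?case
      unfolding card_edges_before_Suc by (cases "v \<in> balanced_edges n C") simp_all
  qed
qed

lemma even_card_balanced_edges:
  assumes n: "n \<ge> 1"
  shows "even (card (balanced_edges n C))"
proof -
  have "{e \<in> balanced_edges n C. e < Suc n} = balanced_edges n C"
    by (auto simp: balanced_edges_def)
  then have "card (balanced_edges n C) =
      card {e \<in> balanced_edges n C. e < n} + (if n \<in> balanced_edges n C then 1 else 0)"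
    using card_edges_before_Suc[of "balanced_edges n C" n] by simp
  moreover have "n \<in> balanced_edges n C \<longleftrightarrow> C n \<noteq> C 1"
    using n by (simp add: balanced_edges_def)
  ultimately show ?thesis
    using color_eq_first_iff[of n n C] n by auto
qed

text \<open>
  Conversely, given a first color and an even set of edges, flipping at exactly these edges gives a
  coloring; evenness makes edge \<open>n\<close>, which leads back to vertex \<open>1\<close>, come out right as well.
\<close>

lemma bij_betw_first_color_balanced_edges:
  assumes n: "n \<ge> 1"
  shows "bij_betw (\<lambda>C. (C 1, balanced_edges n C)) (colorings (cycle n))
           (UNIV \<times> {D. D \<subseteq> {1..n} \<and> even (card D)})"
  unfolding bij_betw_def
proof
  show "inj_on (\<lambda>C. (C 1, balanced_edges n C)) (colorings (cycle n))"
  proof (rule inj_onI)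
    fix C C' assume C: "C \<in> colorings (cycle n)" "C' \<in> colorings (cycle n)"
      and "(C 1, balanced_edges n C) = (C' 1, balanced_edges n C')"
    then have eq: "C 1 = C' 1" "balanced_edges n C = balanced_edges n C'" by auto
    show "C = C'"
    proof (rule PiE_ext)
      show "C \<in> {1..n} \<rightarrow>\<^sub>E UNIV" "C' \<in> {1..n} \<rightarrow>\<^sub>E UNIV"
        using C by (simp_all add: colorings_def cycle_def)
      fix v assume "v \<in> {1..n}"
      then have "C v = C 1 \<longleftrightarrow> C' v = C 1"
        using color_eq_first_iff[of v n C] color_eq_first_iff[of v n C'] eq by simp
      then show "C v = C' v" by (metis color.exhaust)
    qed
  qed
next
  show "(\<lambda>C. (C 1, balanced_edges n C)) ` colorings (cycle n) =
      UNIV \<times> {D. D \<subseteq> {1..n} \<and> even (card D)}"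
  proof (intro equalityI subsetI)
    fix x assume "x \<in> (\<lambda>C. (C 1, balanced_edges n C)) ` colorings (cycle n)"
    then show "x \<in> UNIV \<times> {D. D \<subseteq> {1..n} \<and> even (card D)}"
      using even_card_balanced_edges[OF n] by (auto simp: balanced_edges_def)
  next
    fix x :: "color \<times> nat set" assume "x \<in> UNIV \<times> {D. D \<subseteq> {1..n} \<and> even (card D)}"
    then obtain c D where x: "x = (c, D)" and D: "D \<subseteq> {1..n}" "even (card D)" by auto
    obtain d where d: "d \<noteq> c" by (metis color.distinct(1))
    define C where "C = restrict (\<lambda>v. if even (card {e \<in> D. e < v}) then c else d) {1..n}"
    have "{e \<in> D. e < 1} = {}" using D by auto
    then have "even (card {e \<in> D. e < 1})" by (metis card.empty even_zero)
    moreover have "C 1 = (if even (card {e \<in> D. e < 1}) then c else d)"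
      using n by (simp add: C_def)
    ultimately have C1: "C 1 = c" by (simp only: if_True)
    have "e \<in> D \<longleftrightarrow> C e \<noteq> C (e mod n + 1)" if e: "e \<in> {1..n}" for e
    proof (cases "e = n")
      case False
      then show ?thesis using e d by (auto simp: C_def card_edges_before_Suc)
    next
      case True
      have "{e \<in> D. e < Suc n} = D" using D by auto
      then have "card D = card {e \<in> D. e < n} + (if n \<in> D then 1 else 0)"
        using card_edges_before_Suc[of D n] by simp
      then have "even (card {e \<in> D. e < n}) \<longleftrightarrow> n \<notin> D" using D by auto
      then have "C n = c \<longleftrightarrow> n \<notin> D" using n d by (simp add: C_def)
      then show ?thesis using True C1 by simp
    qed
    then have "balanced_edges n C = D" using D by (auto simp: balanced_edges_def)
    moreover have "C \<in> colorings (cycle n)" by (simp add: C_def colorings_def cycle_def)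
    ultimately show "x \<in> (\<lambda>C. (C 1, balanced_edges n C)) ` colorings (cycle n)"
      using C1 x by force
  qed
qed

section \<open>Integrated colorings with a given mixing number\<close>

lemma card_integrated_colorings_mix:
  assumes n: "n \<ge> 2" and m: "even m" "m \<le> n"
  shows "card {C \<in> integrated_colorings (cycle n). mix (cycle n) C = m} =
    2 * card {U. U \<subseteq> {1..n} \<and> card U = n - m \<and> cyclic_sparse n U}"
    (is "card ?I = 2 * card ?U")
proof -
  let ?f = "\<lambda>C. (C 1, balanced_edges n C)"
  let ?D = "{D. D \<subseteq> {1..n} \<and> card D = m \<and> cyclic_sparse n ({1..n} - D)}"
  have bij: "bij_betw ?f (colorings (cycle n)) (UNIV \<times> {D. D \<subseteq> {1..n} \<and> even (card D)})"
    using n by (intro bij_betw_first_color_balanced_edges) simp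
  have I: "?I = {C \<in> colorings (cycle n). ?f C \<in> UNIV \<times> ?D}"
    by (auto simp: integrated_colorings_def mix_cycle integrated_cycle_iff[OF n] balanced_edges_def)
  have "?f ` ?I = UNIV \<times> ?D"
  proof -
    have "UNIV \<times> ?D \<subseteq> ?f ` colorings (cycle n)"
      unfolding bij_betw_imp_surj_on[OF bij] using m by auto
    then show ?thesis unfolding I by blast
  qed
  moreover have "inj_on ?f ?I"
    by (rule inj_on_subset[OF bij_betw_imp_inj_on[OF bij]]) (auto simp: I)
  ultimately have "card ?I = card ((UNIV :: color set) \<times> ?D)"
    by (simp only: card_image[symmetric])
  also have "\<dots> = 2 * card ?D"
  proof -
    have "(UNIV :: color set) = {Black, White}" using color.exhaust by auto
    then have "CARD(color) = 2" by (metis card_2_iff color.distinct(1))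
    then show ?thesis by (simp add: card_cartesian_product)
  qed
  also have "card ?D = card ?U"
  proof (rule bij_betw_same_card)
    show "bij_betw (\<lambda>D. {1..n} - D) ?D ?U"
    proof (rule bij_betw_byWitness[where f' = "\<lambda>U. {1..n} - U"])
      have compl: "card ({1..n} - D) = n - card D" if "D \<subseteq> {1..n}" for D
        using that finite_subset[OF that] by (simp add: card_Diff_subset)
      show "(\<lambda>D. {1..n} - D) ` ?D \<subseteq> ?U"
        by (simp add: image_subset_iff compl del: One_nat_def)
      show "(\<lambda>U. {1..n} - U) ` ?U \<subseteq> ?D"
        using m by (simp add: image_subset_iff compl double_diff del: One_nat_def)
    qed (auto simp: double_diff)
  qed
  finally show ?thesis .
qed

lemma binom_int: "binom (int a) (int b) = a choose b"
  by (simp add: binom_def binomial_eq_0)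

theorem theorem11:
  fixes n :: nat and k :: int
  assumes "n \<ge> 2"
    and "\<lceil>real n / 4\<rceil> \<le> k"
    and "k \<le> \<lfloor>real n / 2\<rfloor>"
  shows "measure_pmf.prob (pmf_of_set (integrated_colorings (cycle n)))
           {C. int (mix (cycle n) C) = 2 * k} =
         (2 * real (binom (2 * k - 1) (int n - 2 * k))
           + 4 * real (binom (2 * k - 1) (int n - 2 * k - 1)))
         / real (ic (cycle n))"
proof -
  \<comment> \<open>Positivity of \<open>k\<close> lets Pascal's rule be applied to row \<open>2k\<close> below.\<close>
  have "0 < real n / 4" using assms(1) by simp
  also have "\<dots> \<le> of_int k" using assms(2) by (simp add: ceiling_le_iff)
  finally have "k > 0" by simp
  then obtain j where j: "k = int j" "j \<ge> 1"
    by (metis nat_0_le less_imp_le of_nat_0_less_iff One_nat_def Suc_leI)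
  have "of_int k \<le> real n / 2" using assms(3) by (simp add: le_floor_iff)
  then have jn: "2 * j \<le> n" using j by simp
  define u where "u = n - 2 * j"
  have n: "n = 2 * j + u" using jn by (simp add: u_def)
  let ?I = "integrated_colorings (cycle n)"
  have "?I \<inter> {C. int (mix (cycle n) C) = 2 * k} = {C \<in> ?I. mix (cycle n) C = 2 * j}"
    using j by auto
  then have "measure_pmf.prob (pmf_of_set ?I) {C. int (mix (cycle n) C) = 2 * k} =
      real (card {C \<in> ?I. mix (cycle n) C = 2 * j}) / real (ic (cycle n))"
    using measure_pmf_of_set[OF integrated_colorings_cycle_nonempty[OF assms(1)]
        finite_integrated_colorings[OF finite_multigraph_cycle[OF assms(1)]]]
    by (simp add: ic_def)
  also have "card {C \<in> ?I. mix (cycle n) C = 2 * j} =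
      2 * (((2 * j) choose u) + (if u = 0 then 0 else (2 * j - 1) choose (u - 1)))"
    using card_integrated_colorings_mix[of n "2 * j"] card_cyclic_sparse_subsets[of n u] assms(1)
    by (simp add: n)
  \<comment> \<open>Pascal's rule splits the first coefficient; its second part doubles the one already there.\<close>
  also have "\<dots> = 2 * ((2 * j - 1) choose u) + 4 * (if u = 0 then 0 else (2 * j - 1) choose (u - 1))"
  proof (cases u)
    case (Suc w)
    obtain i where "2 * j = Suc i" using j(2) by (cases "2 * j") auto
    then show ?thesis using Suc by simp
  qed simp
  also have "(2 * j - 1) choose u = binom (2 * k - 1) (int n - 2 * k)"
  proof -
    have "2 * k - 1 = int (2 * j - 1)" "int n - 2 * k = int u" using j n by auto
    then show ?thesis by (simp only: binom_int)
  qed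
  also have "(if u = 0 then 0 else (2 * j - 1) choose (u - 1)) =
      binom (2 * k - 1) (int n - 2 * k - 1)"
  proof (cases "u = 0")
    case False
    then have "2 * k - 1 = int (2 * j - 1)" "int n - 2 * k - 1 = int (u - 1)" using j n by auto
    then show ?thesis using False by (simp only: binom_int if_False)
  qed (use j n in \<open>simp add: binom_def\<close>)
  finally show ?thesis by simp
qed

end
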